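(* For every sequence $\alpha:\mathbb{N}\to\mathbb{N}$ and every closed System T term $t$ of type $(\iota\Rightarrow\iota)\Rightarrow\iota$, we have $[\![t]\!]\,\alpha = \mathsf{dialogue}\,(\mathsf{dialogueTree}(t))\,\alpha$.
   Context: Metatheory: constructive Martin-Löf type theory (with $\Pi$, $\Sigma$, inductive types, a universe), without function extensionality; "$=$" is the identity type. $\mathsf{Natrec}\,f\,x\,0 = x$, $\mathsf{Natrec}\,f\,x\,(n+1) = f\,n\,(\mathsf{Natrec}\,f\,x\,n)$. System T: types are generated by a base type $\iota$ and function types $\sigma\Rightarrow\tau$. Contexts are finite lists of distinct typed variables. Terms $\Gamma\vdash t:\sigma$ are: variables $x$ with $(x:\sigma)\in\Gamma$; $\mathsf{zero}:\iota$; $\mathsf{succ}\,t:\iota$ for $t:\iota$; $\mathsf{rec}_\sigma\,t\,p\,q:\sigma$ for $t:\iota\Rightarrow\sigma\Rightarrow\sigma$, $p:\sigma$, $q:\iota$; $\lambda x{:}\sigma.\,t:\sigma\Rightarrow\tau$ for $\Gamma,x{:}\sigma\vdash t:\tau$; application $t\,p:\tau$ for $t:\sigma\Rightarrow\tau$, $p:\sigma$. Closed terms are terms in the empty context. Set interpretation: $[\![\iota]\!]=\mathbb{N}$, $[\![\sigma\Rightarrow\tau]\!]=[\![\sigma]\!]\to[\![\tau]\!]$; for an assignment $\gamma$ of elements of $[\![\sigma]\!]$ to each $(x:\sigma)\in\Gamma$: $[\![x]\!]\gamma=\gamma(x)$, $[\![\mathsf{zero}]\!]\gamma=0$, $[\![\mathsf{succ}\,t]\!]\gamma=[\![t]\!]\gamma+1$,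 $[\![\mathsf{rec}_\sigma\,t_1\,t_2\,t_3]\!]\gamma=\mathsf{Natrec}([\![t_1]\!]\gamma)([\![t_2]\!]\gamma)([\![t_3]\!]\gamma)$, $[\![\lambda x.t]\!]\gamma=\lambda a.[\![t]\!](\gamma,x\mapsto a)$, $[\![t\,p]\!]\gamma=[\![t]\!]\gamma\,([\![p]\!]\gamma)$. For closed $t$ write $[\![t]\!]$. Dialogue trees: for types $I,O,X$, $\mathcal{D}(I,O,X)$ is the inductive type with constructors $\eta\,x$ ($x:X$) and $\beta\,\varphi\,i$ ($\varphi:O\to\mathcal{D}(I,O,X)$, $i:I$); $\mathcal{D}_{\mathbb N}X:=\mathcal{D}(\mathbb{N},\mathbb{N},X)$. $\mathsf{dialogue}(\eta\,x)\,\alpha=x$, $\mathsf{dialogue}(\beta\,\varphi\,i)\,\alpha=\mathsf{dialogue}(\varphi(\alpha\,i))\,\alpha$. Kleisli extension: for $f:X\to\mathcal{D}(I,O,Y)$, $f^\sharp(\eta\,x)=f\,x$, $f^\sharp(\beta\,\varphi\,i)=\beta\,(\lambda o.f^\sharp(\varphi\,o))\,i$; $\mathsf{map}\,f:=(\eta\circ f)^\sharp$. Dialogue interpretation: $\mathcal{B}[\![\iota]\!]=\mathcal{D}_{\mathbb N}\mathbb{N}$, $\mathcal{B}[\![\sigma\Rightarrow\tau]\!]=\mathcal{B}[\![\sigma]\!]\to\mathcal{B}[\![\tau]\!]$. Generalised Kleisli extension $\mathsf{ext}_\sigma:(\mathbb{N}\to\mathcal{B}[\![\sigma]\!])\to\mathcal{D}_{\mathbb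 N}\mathbb{N}\to\mathcal{B}[\![\sigma]\!]$: $\mathsf{ext}_\iota\,f\,d=f^\sharp\,d$, $\mathsf{ext}_{\sigma_1\Rightarrow\sigma_2}\,f\,d\,s=\mathsf{ext}_{\sigma_2}(\lambda x.f\,x\,s)\,d$. For $\gamma$ assigning elements of $\mathcal{B}[\![\sigma]\!]$ to variables: $\mathcal{B}[\![x]\!]\gamma=\gamma(x)$, $\mathcal{B}[\![\mathsf{zero}]\!]\gamma=\eta\,0$, $\mathcal{B}[\![\mathsf{succ}\,t]\!]\gamma=\mathsf{map}(\lambda n.n+1)(\mathcal{B}[\![t]\!]\gamma)$, $\mathcal{B}[\![\mathsf{rec}_\sigma\,t_1\,t_2\,t_3]\!]\gamma=\mathsf{ext}_\sigma(\mathsf{Natrec}(\mathcal{B}[\![t_1]\!]\gamma\circ\eta)(\mathcal{B}[\![t_2]\!]\gamma))(\mathcal{B}[\![t_3]\!]\gamma)$, $\mathcal{B}[\![\lambda x.t]\!]\gamma=\lambda a.\mathcal{B}[\![t]\!](\gamma,x\mapsto a)$, $\mathcal{B}[\![t\,p]\!]\gamma=\mathcal{B}[\![t]\!]\gamma(\mathcal{B}[\![p]\!]\gamma)$. The generic sequence is $\mathsf{generic}:=(\lambda i.\beta\,\eta\,i)^\sharp:\mathcal{D}_{\mathbb N}\mathbb{N}\to\mathcal{D}_{\mathbb N}\mathbb{N}$, and for closed $t:(\iota\Rightarrow\iota)\Rightarrow\iota$, $\mathsf{dialogueTree}(t):=\mathcal{B}[\![t]\!]\,\mathsf{generic}\in\mathcal{D}_{\mathbb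 N}\mathbb{N}$. *)

theory Defs
  imports Main "HOL-Library.FuncSet"
begin

section \<open>System T\<close>

datatype ty = Iota (\<open>\<iota>\<close>) | Fn ty ty (infixr \<open>\<Rrightarrow>\<close> 60)

type_synonym var = nat
type_synonym ctx = "(var \<times> ty) list"

datatype tm =
    Var var
  | Zero
  | Succ tm
  | Rec ty tm tm tm
  | Lam var ty tm
  | App tm tm

text \<open>The freshness premise of the rule for \<open>Lam\<close> keeps the variables of a context distinct in every
  derivation that starts from a distinct (in particular, from the empty) context.\<close>

inductive typing :: "ctx \<Rightarrow> tm \<Rightarrow> ty \<Rightarrow> bool" (\<open>_ \<turnstile> _ : _\<close> [50, 50, 50] 50) where
  t_var:  "(x, \<sigma>) \<in> set \<Gamma> \<Longrightarrow> \<Gamma> \<turnstile> Var x : \<sigma>"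
| t_zero: "\<Gamma> \<turnstile> Zero : \<iota>"
| t_succ: "\<Gamma> \<turnstile> t : \<iota> \<Longrightarrow> \<Gamma> \<turnstile> Succ t : \<iota>"
| t_rec:  "\<Gamma> \<turnstile> t : \<iota> \<Rrightarrow> \<sigma> \<Rrightarrow> \<sigma> \<Longrightarrow> \<Gamma> \<turnstile> p : \<sigma> \<Longrightarrow> \<Gamma> \<turnstile> q : \<iota> \<Longrightarrow> \<Gamma> \<turnstile> Rec \<sigma> t p q : \<sigma>"
| t_lam:  "x \<notin> fst ` set \<Gamma> \<Longrightarrow> (x, \<sigma>) # \<Gamma> \<turnstile> t : \<tau> \<Longrightarrow> \<Gamma> \<turnstile> Lam x \<sigma> t : \<sigma> \<Rrightarrow> \<tau>"
| t_app:  "\<Gamma> \<turnstile> t : \<sigma> \<Rrightarrow> \<tau> \<Longrightarrow> \<Gamma> \<turnstile> p : \<sigma> \<Longrightarrow> \<Gamma> \<turnstile> App t p : \<tau>"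

lemma typing_unique:
  assumes "\<Gamma> \<turnstile> t : \<sigma>" "\<Gamma> \<turnstile> t : \<tau>" "distinct (map fst \<Gamma>)"
  shows "\<sigma> = \<tau>"
  using assms
proof (induction arbitrary: \<tau> rule: typing.induct)
  case (t_var x \<sigma> \<Gamma>)
  then show ?case by (auto elim!: typing.cases[of _ "Var x"] dest: eq_key_imp_eq_value)
next
  case (t_zero \<Gamma>)
  then show ?case by (auto elim: typing.cases)
next
  case (t_succ \<Gamma> t)
  then show ?case by (auto elim: typing.cases)
next
  case (t_rec \<Gamma> t \<sigma> p q)
  from t_rec.prems(1) show ?case by cases auto
next
  case (t_lam x \<Gamma> \<sigma> t \<tau>)
  from t_lam.prems(1) show ?case
    by cases (use t_lam in auto)
next
  case (t_app \<Gamma> t \<sigma> \<tau> p)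
  from t_app.prems(1) show ?case
    by cases (use t_app in blast)
qed

definition type_of :: "ctx \<Rightarrow> tm \<Rightarrow> ty" where
  "type_of \<Gamma> t = (THE \<tau>. \<Gamma> \<turnstile> t : \<tau>)"

lemma type_of_eq: "\<Gamma> \<turnstile> t : \<sigma> \<Longrightarrow> distinct (map fst \<Gamma>) \<Longrightarrow> type_of \<Gamma> t = \<sigma>"
  unfolding type_of_def using typing_unique by blast

primrec components :: "ty \<Rightarrow> ty set" where
  "components \<iota> = {\<iota>}"
| "components (\<sigma> \<Rrightarrow> \<tau>) = {\<sigma> \<Rrightarrow> \<tau>} \<union> components \<sigma> \<union> components \<tau>"

fun subterm_types :: "ctx \<Rightarrow> tm \<Rightarrow> ty set" where
  "subterm_types \<Gamma> (Var x) = {type_of \<Gamma> (Var x)}"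
| "subterm_types \<Gamma> Zero = {\<iota>}"
| "subterm_types \<Gamma> (Succ t) = {\<iota>} \<union> subterm_types \<Gamma> t"
| "subterm_types \<Gamma> (Rec \<sigma> t p q) =
     {\<sigma>} \<union> subterm_types \<Gamma> t \<union> subterm_types \<Gamma> p \<union> subterm_types \<Gamma> q"
| "subterm_types \<Gamma> (Lam x \<sigma> t) =
     {type_of \<Gamma> (Lam x \<sigma> t)} \<union> subterm_types ((x, \<sigma>) # \<Gamma>) t"
| "subterm_types \<Gamma> (App t p) =
     {type_of \<Gamma> (App t p)} \<union> subterm_types \<Gamma> t \<union> subterm_types \<Gamma> p"

definition types_in :: "tm \<Rightarrow> ty set" where
  "types_in t = (\<Union>\<sigma> \<in> subterm_types [] t. components \<sigma>)"


section \<open>Full function hierarchies\<close>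

text \<open>
  The family of sets with value a given set \<open>'b\<close> at \<open>\<iota>\<close> and the set of all functions at function
  types is not a family of subsets of one type that HOL can construct: their union has at least the
  cardinality of the \<open>\<omega>\<close>-th beth number. But the finitely many types that occur in a single term
  do have a joint universe. So the hierarchy is given by a universe \<open>'u\<close> with a carrier for
  each type, and \<open>full S H\<close> states that, at the types in \<open>S\<close>, the carriers are (up to the bijections
  \<open>incl\<close> and \<open>app\<close>) exactly \<open>'b\<close> and the full function spaces. This determines the hierarchy on
  the components-closed set \<open>S\<close> up to unique isomorphism.
\<close>

record ('b, 'u) hierarchy =
  El :: "ty \<Rightarrow> 'u set"
  incl :: "'b \<Rightarrow> 'u"
  app :: "'u \<Rightarrow> 'u \<Rightarrow> 'u"

definition full :: "ty set \<Rightarrow> ('b, 'u) hierarchy \<Rightarrow> bool" where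
  "full S H \<longleftrightarrow>
     (\<iota> \<in> S \<longrightarrow> bij_betw (incl H) UNIV (El H \<iota>)) \<and>
     (\<forall>\<sigma> \<tau>. \<sigma> \<Rrightarrow> \<tau> \<in> S \<longrightarrow>
        bij_betw (\<lambda>g. restrict (app H g) (El H \<sigma>)) (El H (\<sigma> \<Rrightarrow> \<tau>)) (El H \<sigma> \<rightarrow>\<^sub>E El H \<tau>))"

definition val :: "('b, 'u) hierarchy \<Rightarrow> 'u \<Rightarrow> 'b" where
  "val H = inv (incl H)"

definition lam :: "('b, 'u) hierarchy \<Rightarrow> ty \<Rightarrow> ty \<Rightarrow> ('u \<Rightarrow> 'u) \<Rightarrow> 'u" where
  "lam H \<sigma> \<tau> f =
     inv_into (El H (\<sigma> \<Rrightarrow> \<tau>)) (\<lambda>g. restrict (app H g) (El H \<sigma>)) (restrict f (El H \<sigma>))"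

text \<open>The element of the carrier of \<open>\<iota> \<Rrightarrow> \<iota>\<close> that represents a function on \<open>'b\<close>.\<close>

definition lift :: "('b, 'u) hierarchy \<Rightarrow> ('b \<Rightarrow> 'b) \<Rightarrow> 'u" where
  "lift H h = lam H \<iota> \<iota> (\<lambda>x. incl H (h (val H x)))"

lemma full_mono: "full T H \<Longrightarrow> S \<subseteq> T \<Longrightarrow> full S H"
  unfolding full_def by blast

lemma val_incl: "full S H \<Longrightarrow> \<iota> \<in> S \<Longrightarrow> val H (incl H b) = b"
  unfolding full_def val_def by (auto simp: bij_betw_def)

lemma lam_app:
  assumes "full S H" "\<sigma> \<Rrightarrow> \<tau> \<in> S" "f \<in> El H \<sigma> \<rightarrow> El H \<tau>"
  shows "lam H \<sigma> \<tau> f \<in> El H (\<sigma> \<Rrightarrow> \<tau>)"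
    and "a \<in> El H \<sigma> \<Longrightarrow> app H (lam H \<sigma> \<tau> f) a = f a"
proof -
  let ?F = "\<lambda>g. restrict (app H g) (El H \<sigma>)"
  have bij: "bij_betw ?F (El H (\<sigma> \<Rrightarrow> \<tau>)) (El H \<sigma> \<rightarrow>\<^sub>E El H \<tau>)"
    using assms unfolding full_def by blast
  have "restrict f (El H \<sigma>) \<in> El H \<sigma> \<rightarrow>\<^sub>E El H \<tau>"
    using assms(3) by auto
  then have im: "restrict f (El H \<sigma>) \<in> ?F ` El H (\<sigma> \<Rrightarrow> \<tau>)"
    using bij by (simp add: bij_betw_def)
  show "lam H \<sigma> \<tau> f \<in> El H (\<sigma> \<Rrightarrow> \<tau>)"
    unfolding lam_def by (rule inv_into_into[OF im])
  have "?F (lam H \<sigma> \<tau> f) = restrict f (El H \<sigma>)"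
    unfolding lam_def by (rule f_inv_into_f[OF im])
  then show "app H (lam H \<sigma> \<tau> f) a = f a" if "a \<in> El H \<sigma>"
    using that by (metis restrict_apply')
qed

text \<open>
  Full hierarchies exist for every term: one over \<open>'b\<close> that is full at rank \<open>0\<close> has universe \<open>'b\<close>,
  and each further rank is reached by enlarging the universe from \<open>'u\<close> to \<open>'u + ('u \<Rightarrow> 'u)\<close>.
\<close>

primrec rank :: "ty \<Rightarrow> nat" where
  "rank \<iota> = 0"
| "rank (\<sigma> \<Rrightarrow> \<tau>) = Suc (max (rank \<sigma>) (rank \<tau>))"

lemma full_rank_0: "\<exists>H :: ('b, 'b) hierarchy. full {\<sigma>. rank \<sigma> \<le> 0} H"
  by (rule exI[of _ "\<lparr>El = \<lambda>_. UNIV, incl = id, app = \<lambda>x _. x\<rparr>"]) (simp add: full_def)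

lemma bij_betw_funcset_Inl:
  "bij_betw (\<lambda>h. \<lambda>y \<in> Inl ` A. Inl (h (projl y))) (A \<rightarrow>\<^sub>E C)
     ((Inl ` A :: ('u + 'w) set) \<rightarrow>\<^sub>E (Inl ` C :: ('u + 'w) set))"
proof (rule bij_betw_byWitness[where f' = "\<lambda>k. \<lambda>x \<in> A. projl (k (Inl x))"])
  show "\<forall>h \<in> A \<rightarrow>\<^sub>E C. (\<lambda>x \<in> A. projl ((\<lambda>y \<in> Inl ` A. Inl (h (projl y)) :: 'u + 'w) (Inl x))) = h"
  proof
    fix h assume h: "h \<in> A \<rightarrow>\<^sub>E C"
    show "(\<lambda>x \<in> A. projl ((\<lambda>y \<in> Inl ` A. Inl (h (projl y)) :: 'u + 'w) (Inl x))) = h"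
    proof (rule ext)
      fix x
      show "(\<lambda>x \<in> A. projl ((\<lambda>y \<in> Inl ` A. Inl (h (projl y)) :: 'u + 'w) (Inl x))) x = h x"
        using PiE_arb[OF h, of x] by (cases "x \<in> A") simp_all
    qed
  qed
  show "\<forall>k \<in> (Inl ` A :: ('u + 'w) set) \<rightarrow>\<^sub>E (Inl ` C :: ('u + 'w) set).
          (\<lambda>y \<in> Inl ` A. Inl ((\<lambda>x \<in> A. projl (k (Inl x))) (projl y))) = k"
  proof
    fix k assume k: "k \<in> (Inl ` A :: ('u + 'w) set) \<rightarrow>\<^sub>E (Inl ` C :: ('u + 'w) set)"
    show "(\<lambda>y \<in> Inl ` A. Inl ((\<lambda>x \<in> A. projl (k (Inl x))) (projl y))) = k"
    proof (rule ext)
      fix y :: "'u + 'w"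
      show "(\<lambda>y \<in> Inl ` A. Inl ((\<lambda>x \<in> A. projl (k (Inl x))) (projl y))) y = k y"
      proof (cases "y \<in> Inl ` A")
        case True
        then obtain x where x: "x \<in> A" "y = Inl x" by blast
        obtain c where "k y = Inl c" using PiE_mem[OF k True] by blast
        then show ?thesis using x by simp
      next
        case False
        then show ?thesis using PiE_arb[OF k False] by simp
      qed
    qed
  qed
  show "(\<lambda>h. \<lambda>y \<in> Inl ` A. Inl (h (projl y))) ` (A \<rightarrow>\<^sub>E C)
        \<subseteq> (Inl ` A :: ('u + 'w) set) \<rightarrow>\<^sub>E (Inl ` C :: ('u + 'w) set)"
  proof (rule image_subsetI, rule restrict_PiE_iff[THEN iffD2], rule ballI)
    fix h y assume "h \<in> A \<rightarrow>\<^sub>E C" "y \<in> (Inl ` A :: ('u + 'w) set)"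
    then show "Inl (h (projl y)) \<in> (Inl ` C :: ('u + 'w) set)" using PiE_mem by fastforce
  qed
  show "(\<lambda>k. \<lambda>x \<in> A. projl (k (Inl x))) ` ((Inl ` A :: ('u + 'w) set) \<rightarrow>\<^sub>E (Inl ` C :: ('u + 'w) set))
        \<subseteq> A \<rightarrow>\<^sub>E C"
  proof (rule image_subsetI, rule restrict_PiE_iff[THEN iffD2], rule ballI)
    fix k x assume k: "k \<in> (Inl ` A :: ('u + 'w) set) \<rightarrow>\<^sub>E (Inl ` C :: ('u + 'w) set)" and "x \<in> A"
    then have "k (Inl x) \<in> Inl ` C" using PiE_mem[OF k] by blast
    then show "projl (k (Inl x)) \<in> C" by auto
  qed
qed

lemma full_rank_Suc:
  fixes H :: "('b, 'u) hierarchy"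
  assumes "full {\<sigma>. rank \<sigma> \<le> n} H"
  shows "\<exists>H' :: ('b, 'u + ('u \<Rightarrow> 'u)) hierarchy. full {\<sigma>. rank \<sigma> \<le> Suc n} H'"
proof -
  define E :: "ty \<Rightarrow> ('u + ('u \<Rightarrow> 'u)) set" where
    "E \<sigma> = (if rank \<sigma> \<le> n then Inl ` El H \<sigma>
       else case \<sigma> of \<iota> \<Rightarrow> {} | \<sigma>1 \<Rrightarrow> \<sigma>2 \<Rightarrow> Inr ` (El H \<sigma>1 \<rightarrow>\<^sub>E El H \<sigma>2))" for \<sigma>
  define ap :: "('u + ('u \<Rightarrow> 'u)) \<Rightarrow> ('u + ('u \<Rightarrow> 'u)) \<Rightarrow> 'u + ('u \<Rightarrow> 'u)" where
    "ap g y = Inl ((case g of Inl f \<Rightarrow> app H f | Inr f \<Rightarrow> f) (projl y))" for g y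
  define H' where "H' = \<lparr>El = E, incl = \<lambda>b. Inl (incl H b), app = ap\<rparr>"
  have base: "bij_betw (incl H') UNIV (El H' \<iota>)"
    using assms by (auto simp: full_def H'_def E_def bij_betw_def inj_on_def)
  have "bij_betw (\<lambda>g. restrict (ap g) (E \<sigma>)) (E (\<sigma> \<Rrightarrow> \<tau>)) (E \<sigma> \<rightarrow>\<^sub>E E \<tau>)"
    if r: "rank (\<sigma> \<Rrightarrow> \<tau>) \<le> Suc n" for \<sigma> \<tau>
  proof -
    let ?tr = "\<lambda>h. \<lambda>y \<in> Inl ` El H \<sigma>. Inl (h (projl y)) :: 'u + ('u \<Rightarrow> 'u)"
    have E: "E \<sigma> = Inl ` El H \<sigma>" "E \<tau> = Inl ` El H \<tau>" using r by (auto simp: E_def)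
    have tr: "bij_betw ?tr (El H \<sigma> \<rightarrow>\<^sub>E El H \<tau>) (E \<sigma> \<rightarrow>\<^sub>E E \<tau>)"
      unfolding E by (rule bij_betw_funcset_Inl)
    show ?thesis
    proof (cases "rank (\<sigma> \<Rrightarrow> \<tau>) \<le> n")
      case True
      let ?F = "\<lambda>g. restrict (app H g) (El H \<sigma>)"
      have E2: "E (\<sigma> \<Rrightarrow> \<tau>) = Inl ` El H (\<sigma> \<Rrightarrow> \<tau>)"
        using True by (simp add: E_def del: rank.simps)
      have "bij_betw ?F (El H (\<sigma> \<Rrightarrow> \<tau>)) (El H \<sigma> \<rightarrow>\<^sub>E El H \<tau>)"
        using assms True unfolding full_def by blast
      moreover have "bij_betw projl (E (\<sigma> \<Rrightarrow> \<tau>)) (El H (\<sigma> \<Rrightarrow> \<tau>))"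
        by (auto simp: E2 bij_betw_def inj_on_def image_image)
      ultimately have "bij_betw (?tr \<circ> (?F \<circ> projl)) (E (\<sigma> \<Rrightarrow> \<tau>)) (E \<sigma> \<rightarrow>\<^sub>E E \<tau>)"
        using tr by (blast intro: bij_betw_trans)
      moreover have "(?tr \<circ> (?F \<circ> projl)) g = restrict (ap g) (E \<sigma>)" if "g \<in> E (\<sigma> \<Rrightarrow> \<tau>)" for g
        using that by (auto simp: E E2 ap_def fun_eq_iff)
      ultimately show ?thesis by (subst bij_betw_cong[symmetric]) auto
    next
      case False
      then have E2: "E (\<sigma> \<Rrightarrow> \<tau>) = Inr ` (El H \<sigma> \<rightarrow>\<^sub>E El H \<tau>)"
        by (simp add: E_def del: rank.simps)
      then have "bij_betw projr (E (\<sigma> \<Rrightarrow> \<tau>)) (El H \<sigma> \<rightarrow>\<^sub>E El H \<tau>)"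
        by (auto simp: bij_betw_def inj_on_def image_image)
      then have "bij_betw (?tr \<circ> projr) (E (\<sigma> \<Rrightarrow> \<tau>)) (E \<sigma> \<rightarrow>\<^sub>E E \<tau>)"
        using tr by (rule bij_betw_trans)
      moreover have "(?tr \<circ> projr) g = restrict (ap g) (E \<sigma>)" if "g \<in> E (\<sigma> \<Rrightarrow> \<tau>)" for g
        using that by (auto simp: E E2 ap_def fun_eq_iff)
      ultimately show ?thesis by (subst bij_betw_cong[symmetric]) auto
    qed
  qed
  with base have "full {\<sigma>. rank \<sigma> \<le> Suc n} H'"
    by (auto simp: full_def H'_def simp del: rank.simps)
  then show ?thesis by blast
qed

lemma types_in_rank: "\<exists>n. types_in t \<subseteq> {\<sigma>. rank \<sigma> \<le> n}"
proof -
  have "finite (components \<sigma>)" for \<sigma> by (induction \<sigma>) auto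
  moreover have "finite (subterm_types \<Gamma> t)" for \<Gamma>
    by (induction \<Gamma> t rule: subterm_types.induct) auto
  ultimately have "finite (types_in t)" unfolding types_in_def by blast
  then have "\<forall>\<sigma> \<in> types_in t. rank \<sigma> \<le> Max (rank ` types_in t)" by simp
  then show ?thesis by blast
qed


section \<open>Set interpretation\<close>

primrec natrec :: "(nat \<Rightarrow> 'a \<Rightarrow> 'a) \<Rightarrow> 'a \<Rightarrow> nat \<Rightarrow> 'a" where
  "natrec f x 0 = x"
| "natrec f x (Suc n) = f n (natrec f x n)"

fun sem :: "(nat, 'u) hierarchy \<Rightarrow> ctx \<Rightarrow> tm \<Rightarrow> (var \<Rightarrow> 'u) \<Rightarrow> 'u" where
  "sem H \<Gamma> (Var x) \<gamma> = \<gamma> x"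
| "sem H \<Gamma> Zero \<gamma> = incl H 0"
| "sem H \<Gamma> (Succ t) \<gamma> = incl H (val H (sem H \<Gamma> t \<gamma>) + 1)"
| "sem H \<Gamma> (Rec \<sigma> t p q) \<gamma> =
     natrec (\<lambda>n. app H (app H (sem H \<Gamma> t \<gamma>) (incl H n))) (sem H \<Gamma> p \<gamma>) (val H (sem H \<Gamma> q \<gamma>))"
| "sem H \<Gamma> (Lam x \<sigma> t) \<gamma> =
     lam H \<sigma> (type_of ((x, \<sigma>) # \<Gamma>) t) (\<lambda>a. sem H ((x, \<sigma>) # \<Gamma>) t (\<gamma>(x := a)))"
| "sem H \<Gamma> (App t p) \<gamma> = app H (sem H \<Gamma> t \<gamma>) (sem H \<Gamma> p \<gamma>)"

definition sem_closed :: "(nat, 'u) hierarchy \<Rightarrow> tm \<Rightarrow> 'u" where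
  "sem_closed H t = sem H [] t (\<lambda>_. undefined)"


section \<open>Dialogue trees\<close>

datatype ('i, 'o, 'x) D = Eta 'x | Beta "'o \<Rightarrow> ('i, 'o, 'x) D" 'i

type_synonym 'x DN = "(nat, nat, 'x) D"

primrec dialogue :: "('i, 'o, 'x) D \<Rightarrow> ('i \<Rightarrow> 'o) \<Rightarrow> 'x" where
  "dialogue (Eta x) \<alpha> = x"
| "dialogue (Beta \<phi> i) \<alpha> = dialogue (\<phi> (\<alpha> i)) \<alpha>"

primrec kleisli :: "('x \<Rightarrow> ('i, 'o, 'y) D) \<Rightarrow> ('i, 'o, 'x) D \<Rightarrow> ('i, 'o, 'y) D" where
  "kleisli f (Eta x) = f x"
| "kleisli f (Beta \<phi> i) = Beta (\<lambda>o'. kleisli f (\<phi> o')) i"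

definition mapD :: "('x \<Rightarrow> 'y) \<Rightarrow> ('i, 'o, 'x) D \<Rightarrow> ('i, 'o, 'y) D" where
  "mapD f = kleisli (Eta \<circ> f)"

definition generic :: "nat DN \<Rightarrow> nat DN" where
  "generic = kleisli (\<lambda>i. Beta Eta i)"


section \<open>Dialogue interpretation\<close>

fun ext :: "(nat DN, 'v) hierarchy \<Rightarrow> ty \<Rightarrow> (nat \<Rightarrow> 'v) \<Rightarrow> nat DN \<Rightarrow> 'v" where
  "ext B \<iota> f d = incl B (kleisli (\<lambda>n. val B (f n)) d)"
| "ext B (\<sigma> \<Rrightarrow> \<tau>) f d = lam B \<sigma> \<tau> (\<lambda>s. ext B \<tau> (\<lambda>n. app B (f n) s) d)"

fun bsem :: "(nat DN, 'v) hierarchy \<Rightarrow> ctx \<Rightarrow> tm \<Rightarrow> (var \<Rightarrow> 'v) \<Rightarrow> 'v" where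
  "bsem B \<Gamma> (Var x) \<gamma> = \<gamma> x"
| "bsem B \<Gamma> Zero \<gamma> = incl B (Eta 0)"
| "bsem B \<Gamma> (Succ t) \<gamma> = incl B (mapD (\<lambda>n. n + 1) (val B (bsem B \<Gamma> t \<gamma>)))"
| "bsem B \<Gamma> (Rec \<sigma> t p q) \<gamma> =
     ext B \<sigma> (natrec (\<lambda>n. app B (app B (bsem B \<Gamma> t \<gamma>) (incl B (Eta n)))) (bsem B \<Gamma> p \<gamma>))
       (val B (bsem B \<Gamma> q \<gamma>))"
| "bsem B \<Gamma> (Lam x \<sigma> t) \<gamma> =
     lam B \<sigma> (type_of ((x, \<sigma>) # \<Gamma>) t) (\<lambda>a. bsem B ((x, \<sigma>) # \<Gamma>) t (\<gamma>(x := a)))"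
| "bsem B \<Gamma> (App t p) \<gamma> = app B (bsem B \<Gamma> t \<gamma>) (bsem B \<Gamma> p \<gamma>)"

definition bsem_closed :: "(nat DN, 'v) hierarchy \<Rightarrow> tm \<Rightarrow> 'v" where
  "bsem_closed B t = bsem B [] t (\<lambda>_. undefined)"

definition dialogue_tree :: "(nat DN, 'v) hierarchy \<Rightarrow> tm \<Rightarrow> nat DN" where
  "dialogue_tree B t = val B (app B (bsem_closed B t) (lift B generic))"

end

theory Submission imports Defs begin

text \<open>
  Logical relations: for a fixed \<open>\<alpha>\<close>, a number and a dialogue tree are related if the tree evaluates
  to the number along \<open>\<alpha>\<close>, and functions are related if they map related arguments to related
  values. Every term has related interpretations, and \<open>\<alpha>\<close> is related to \<open>generic\<close>.
\<close>

section \<open>Types available for a term\<close>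

text \<open>\<open>full S H\<close> constrains the carriers only at types in \<open>S\<close>, so an
  induction that descends from a type to its components has to stay inside \<open>S\<close>.\<close>

definition component_closed :: "ty set \<Rightarrow> bool" where
  "component_closed S \<longleftrightarrow> (\<forall>\<sigma> \<tau>. \<sigma> \<Rrightarrow> \<tau> \<in> S \<longrightarrow> \<sigma> \<in> S \<and> \<tau> \<in> S)"

lemma component_closedD:
  "component_closed S \<Longrightarrow> \<sigma> \<Rrightarrow> \<tau> \<in> S \<Longrightarrow> \<sigma> \<in> S"
  "component_closed S \<Longrightarrow> \<sigma> \<Rrightarrow> \<tau> \<in> S \<Longrightarrow> \<tau> \<in> S"
  unfolding component_closed_def by blast+

lemma components_self: "\<sigma> \<in> components \<sigma>"
  by (cases \<sigma>) auto

lemma component_closed_components: "component_closed (components \<sigma>)"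
proof (induction \<sigma>)
  case Iota
  show ?case by (simp add: component_closed_def)
next
  case (Fn \<sigma> \<tau>)
  show ?case
    unfolding component_closed_def components.simps
    using component_closedD[OF Fn.IH(1)] component_closedD[OF Fn.IH(2)] components_self by blast
qed

text \<open>A union of component-closed sets is component-closed.\<close>

lemma component_closed_types_in: "component_closed (types_in t)"
  unfolding component_closed_def types_in_def
proof (intro allI impI)
  fix \<sigma> \<tau>
  assume "\<sigma> \<Rrightarrow> \<tau> \<in> (\<Union>\<rho> \<in> subterm_types [] t. components \<rho>)"
  then obtain \<rho> where "\<rho> \<in> subterm_types [] t" "\<sigma> \<Rrightarrow> \<tau> \<in> components \<rho>"
    by blast
  moreover from this(2) have "\<sigma> \<in> components \<rho>" "\<tau> \<in> components \<rho>"
    by (rule component_closedD[OF component_closed_components])+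
  ultimately show "\<sigma> \<in> (\<Union>\<rho> \<in> subterm_types [] t. components \<rho>) \<and>
      \<tau> \<in> (\<Union>\<rho> \<in> subterm_types [] t. components \<rho>)"
    by blast
qed

text \<open>The recorded \<open>type_of\<close> is the derived type by uniqueness of typing. This
  brings the function type of an operator into \<open>S\<close>, although the type of the whole term
  does not reveal it.\<close>

lemma type_in_subterm_types:
  assumes "\<Gamma> \<turnstile> t : \<sigma>" "distinct (map fst \<Gamma>)"
  shows "\<sigma> \<in> subterm_types \<Gamma> t"
  using assms(1)
proof cases
  case t_rec
  then show ?thesis by simp
qed (use type_of_eq[OF assms] in simp_all)

lemma subterm_types_subset_types_in: "subterm_types [] t \<subseteq> types_in t"
  using components_self unfolding types_in_def by blast

section \<open>Interpretations lie in the carriers\<close>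

lemma incl_in_El: "full S H \<Longrightarrow> \<iota> \<in> S \<Longrightarrow> incl H b \<in> El H \<iota>"
  unfolding full_def by (auto simp: bij_betw_def)

lemma app_in_El:
  assumes "full S H" "\<sigma> \<Rrightarrow> \<tau> \<in> S" "g \<in> El H (\<sigma> \<Rrightarrow> \<tau>)" "a \<in> El H \<sigma>"
  shows "app H g a \<in> El H \<tau>"
proof -
  have "bij_betw (\<lambda>g. restrict (app H g) (El H \<sigma>)) (El H (\<sigma> \<Rrightarrow> \<tau>)) (El H \<sigma> \<rightarrow>\<^sub>E El H \<tau>)"
    using assms(1,2) unfolding full_def by blast
  then have "restrict (app H g) (El H \<sigma>) \<in> El H \<sigma> \<rightarrow>\<^sub>E El H \<tau>"
    using assms(3) by (rule bij_betw_apply)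
  then show ?thesis using assms(4) by auto
qed

lemma lam_in_El:
  assumes "full S H" "\<sigma> \<Rrightarrow> \<tau> \<in> S" "\<And>a. a \<in> El H \<sigma> \<Longrightarrow> f a \<in> El H \<tau>"
  shows "lam H \<sigma> \<tau> f \<in> El H (\<sigma> \<Rrightarrow> \<tau>)"
  using assms by (intro lam_app(1)) auto

lemma app_lam:
  assumes "full S H" "\<sigma> \<Rrightarrow> \<tau> \<in> S" "\<And>a. a \<in> El H \<sigma> \<Longrightarrow> f a \<in> El H \<tau>" "a \<in> El H \<sigma>"
  shows "app H (lam H \<sigma> \<tau> f) a = f a"
  using assms by (intro lam_app(2)) auto

lemma natrec_closed:
  "x \<in> A \<Longrightarrow> (\<And>n a. a \<in> A \<Longrightarrow> f n a \<in> A) \<Longrightarrow> natrec f x n \<in> A"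
  by (induction n) auto

text \<open>\<open>ext\<close> at a function type is a \<open>lam\<close> whose body is
  \<open>ext\<close> at the codomain for another family, hence the induction on the type with
  \<open>f\<close> generalised.\<close>

lemma ext_in_El:
  assumes "full S B" "component_closed S" "\<sigma> \<in> S" "\<And>n. f n \<in> El B \<sigma>"
  shows "ext B \<sigma> f d \<in> El B \<sigma>"
  using assms(3,4)
proof (induction \<sigma> arbitrary: f)
  case Iota
  then show ?case using incl_in_El[OF assms(1)] by simp
next
  case (Fn \<sigma> \<tau>)
  have "ext B \<tau> (\<lambda>n. app B (f n) s) d \<in> El B \<tau>" if "s \<in> El B \<sigma>" for s
    using component_closedD(2)[OF assms(2) Fn.prems(1)]
      app_in_El[OF assms(1) Fn.prems(1) Fn.prems(2) that]
    by (rule Fn.IH(2))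
  then show ?case
    using lam_in_El[OF assms(1) Fn.prems(1)] by simp
qed

text \<open>The logical relation cannot replace this result: it only speaks of elements with a
  related partner, whereas \<open>lam\<close> represents its body correctly only if the body maps
  the whole carrier into the codomain.\<close>

lemma sem_in_El:
  assumes "\<Gamma> \<turnstile> t : \<sigma>" "distinct (map fst \<Gamma>)" "subterm_types \<Gamma> t \<subseteq> S"
    and "full S H" "component_closed S"
    and "\<And>x \<tau>. (x, \<tau>) \<in> set \<Gamma> \<Longrightarrow> \<gamma> x \<in> El H \<tau>"
  shows "sem H \<Gamma> t \<gamma> \<in> El H \<sigma>"
  using assms(1-3,6)
proof (induction arbitrary: \<gamma> rule: typing.induct)
  case (t_var x \<sigma> \<Gamma>)
  show ?case
    unfolding sem.simps by (rule t_var.prems(3)[OF t_var.hyps])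
next
  case (t_zero \<Gamma>)
  then show ?case
    using incl_in_El[OF assms(4)] by simp
next
  case (t_succ \<Gamma> t)
  have "\<iota> \<in> S"
    using t_succ.prems(2) by simp
  then show ?case
    unfolding sem.simps by (rule incl_in_El[OF assms(4)])
next
  case (t_rec \<Gamma> t \<sigma> p q)
  \<comment> \<open>The type of the step function also yields
    \<open>\<sigma> \<Rrightarrow> \<sigma>\<close>, so both applications made in each iteration
    stay in the carriers.\<close>
  have S: "\<iota> \<Rrightarrow> \<sigma> \<Rrightarrow> \<sigma> \<in> S"
    using type_in_subterm_types[OF t_rec.hyps(1)] t_rec.prems by auto
  note S' = S component_closedD[OF assms(5) S]
  have t: "sem H \<Gamma> t \<gamma> \<in> El H (\<iota> \<Rrightarrow> \<sigma> \<Rrightarrow> \<sigma>)" and p: "sem H \<Gamma> p \<gamma> \<in> El H \<sigma>"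
    using t_rec by auto
  show ?case
    unfolding sem.simps
    using app_in_El[OF assms(4)] incl_in_El[OF assms(4)] t p S'
    by (intro natrec_closed) blast+
next
  case (t_lam x \<Gamma> \<sigma> t \<tau>)
  have S: "\<sigma> \<Rrightarrow> \<tau> \<in> S"
    using type_in_subterm_types[OF typing.t_lam[OF t_lam.hyps(1,2)]] t_lam.prems by auto
  have d: "distinct (map fst ((x, \<sigma>) # \<Gamma>))"
    using t_lam by simp
  have "sem H ((x, \<sigma>) # \<Gamma>) t (\<gamma>(x := a)) \<in> El H \<tau>" if "a \<in> El H \<sigma>" for a
    using t_lam.prems t_lam.hyps(1) that by (intro t_lam.IH d) force+
  then show ?case
    using lam_in_El[OF assms(4) S] type_of_eq[OF t_lam.hyps(2) d] by simp
next
  case (t_app \<Gamma> t \<sigma> \<tau> p)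
  then have "\<sigma> \<Rrightarrow> \<tau> \<in> S"
    using type_in_subterm_types[OF t_app.hyps(1)] by auto
  then show ?case
    using t_app by (auto intro!: app_in_El[OF assms(4)])
qed

lemma bsem_in_El:
  assumes "\<Gamma> \<turnstile> t : \<sigma>" "distinct (map fst \<Gamma>)" "subterm_types \<Gamma> t \<subseteq> S"
    and "full S B" "component_closed S"
    and "\<And>x \<tau>. (x, \<tau>) \<in> set \<Gamma> \<Longrightarrow> \<gamma> x \<in> El B \<tau>"
  shows "bsem B \<Gamma> t \<gamma> \<in> El B \<sigma>"
  using assms(1-3,6)
proof (induction arbitrary: \<gamma> rule: typing.induct)
  case (t_var x \<sigma> \<Gamma>)
  show ?case
    unfolding bsem.simps by (rule t_var.prems(3)[OF t_var.hyps])
next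
  case (t_zero \<Gamma>)
  then show ?case
    using incl_in_El[OF assms(4)] by simp
next
  case (t_succ \<Gamma> t)
  have "\<iota> \<in> S"
    using t_succ.prems(2) by simp
  then show ?case
    unfolding bsem.simps by (rule incl_in_El[OF assms(4)])
next
  case (t_rec \<Gamma> t \<sigma> p q)
  have S: "\<iota> \<Rrightarrow> \<sigma> \<Rrightarrow> \<sigma> \<in> S"
    using type_in_subterm_types[OF t_rec.hyps(1)] t_rec.prems by auto
  note S' = S component_closedD[OF assms(5) S]
  have t: "bsem B \<Gamma> t \<gamma> \<in> El B (\<iota> \<Rrightarrow> \<sigma> \<Rrightarrow> \<sigma>)" and p: "bsem B \<Gamma> p \<gamma> \<in> El B \<sigma>"
    using t_rec by auto
  have "\<sigma> \<in> S"
    using t_rec.prems by simp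
  then show ?case
    unfolding bsem.simps
    using app_in_El[OF assms(4)] incl_in_El[OF assms(4)] t p S'
    by (intro ext_in_El[OF assms(4,5)] natrec_closed) blast+
next
  case (t_lam x \<Gamma> \<sigma> t \<tau>)
  have S: "\<sigma> \<Rrightarrow> \<tau> \<in> S"
    using type_in_subterm_types[OF typing.t_lam[OF t_lam.hyps(1,2)]] t_lam.prems by auto
  have d: "distinct (map fst ((x, \<sigma>) # \<Gamma>))"
    using t_lam by simp
  have "bsem B ((x, \<sigma>) # \<Gamma>) t (\<gamma>(x := a)) \<in> El B \<tau>" if "a \<in> El B \<sigma>" for a
    using t_lam.prems t_lam.hyps(1) that by (intro t_lam.IH d) force+
  then show ?case
    using lam_in_El[OF assms(4) S] type_of_eq[OF t_lam.hyps(2) d] by simp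
next
  case (t_app \<Gamma> t \<sigma> \<tau> p)
  then have "\<sigma> \<Rrightarrow> \<tau> \<in> S"
    using type_in_subterm_types[OF t_app.hyps(1)] by auto
  then show ?case
    using t_app by (auto intro!: app_in_El[OF assms(4)])
qed

section \<open>Evaluation of dialogue trees\<close>

text \<open>Along \<open>\<alpha>\<close>, the composite tree first follows the queries of
  \<open>d\<close> to a leaf and then those of the tree grafted there.\<close>

lemma dialogue_kleisli:
  "dialogue (kleisli f d) \<alpha> = dialogue (f (dialogue d \<alpha>)) \<alpha>"
  by (induction d) auto

lemma dialogue_mapD: "dialogue (mapD f d) \<alpha> = f (dialogue d \<alpha>)"
  by (simp add: mapD_def dialogue_kleisli)

text \<open>Each leaf \<open>i\<close> becomes \<open>Beta Eta i\<close>, which queries position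
  \<open>i\<close> and returns the answer.\<close>

lemma dialogue_generic: "dialogue (generic d) \<alpha> = \<alpha> (dialogue d \<alpha>)"
  by (simp add: generic_def dialogue_kleisli)

section \<open>The logical relation\<close>

text \<open>Membership in the carriers is built in because the universes may contain elements
  outside them, on which \<open>app\<close> and \<open>val\<close> are unconstrained.\<close>

primrec related ::
  "('i \<Rightarrow> 'o) \<Rightarrow> ('x, 'u) hierarchy \<Rightarrow> (('i, 'o, 'x) D, 'v) hierarchy \<Rightarrow> ty \<Rightarrow> 'u \<Rightarrow> 'v \<Rightarrow> bool"
where
  "related \<alpha> H B \<iota> x d \<longleftrightarrow>
     x \<in> El H \<iota> \<and> d \<in> El B \<iota> \<and> val H x = dialogue (val B d) \<alpha>"
| "related \<alpha> H B (\<sigma> \<Rrightarrow> \<tau>) f g \<longleftrightarrow>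
     f \<in> El H (\<sigma> \<Rrightarrow> \<tau>) \<and> g \<in> El B (\<sigma> \<Rrightarrow> \<tau>) \<and>
     (\<forall>x d. related \<alpha> H B \<sigma> x d \<longrightarrow> related \<alpha> H B \<tau> (app H f x) (app B g d))"

lemma related_in_El:
  "related \<alpha> H B \<sigma> x d \<Longrightarrow> x \<in> El H \<sigma>"
  "related \<alpha> H B \<sigma> x d \<Longrightarrow> d \<in> El B \<sigma>"
  by (cases \<sigma>; simp)+

lemma related_app:
  assumes "related \<alpha> H B (\<sigma> \<Rrightarrow> \<tau>) f g" "related \<alpha> H B \<sigma> x d"
  shows "related \<alpha> H B \<tau> (app H f x) (app B g d)"
  using assms by simp

lemma related_incl:
  assumes "full S H" "full S B" "\<iota> \<in> S" "n = dialogue d \<alpha>"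
  shows "related \<alpha> H B \<iota> (incl H n) (incl B d)"
  using assms by (simp add: incl_in_El val_incl)

text \<open>Related arguments lie in the carriers, so both applications beta-reduce to the bodies.
  The two carrier premises cover arguments without a related partner.\<close>

lemma related_lam:
  assumes "full S H" "full S B" "\<sigma> \<Rrightarrow> \<tau> \<in> S"
    and "\<And>a. a \<in> El H \<sigma> \<Longrightarrow> f a \<in> El H \<tau>" "\<And>a. a \<in> El B \<sigma> \<Longrightarrow> g a \<in> El B \<tau>"
    and "\<And>x d. related \<alpha> H B \<sigma> x d \<Longrightarrow> related \<alpha> H B \<tau> (f x) (g d)"
  shows "related \<alpha> H B (\<sigma> \<Rrightarrow> \<tau>) (lam H \<sigma> \<tau> f) (lam B \<sigma> \<tau> g)"
  using assms related_in_El[of \<alpha> H B \<sigma>]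
  by (simp add: lam_in_El[OF assms(1,3)] lam_in_El[OF assms(2,3)]
      app_lam[OF assms(1,3)] app_lam[OF assms(2,3)])

lemma related_natrec:
  assumes "related \<alpha> H B \<sigma> x d"
    and "\<And>n x d. related \<alpha> H B \<sigma> x d \<Longrightarrow> related \<alpha> H B \<sigma> (f n x) (g n d)"
  shows "related \<alpha> H B \<sigma> (natrec f x n) (natrec g d n)"
  using assms by (induction n) auto

text \<open>Evaluation along \<open>\<alpha>\<close> selects the leaf
  \<open>dialogue d \<alpha>\<close>, so only that member of the family counts. At \<iota> this is
  \<open>dialogue_kleisli\<close>; at function types \<open>ext\<close> acts pointwise.\<close>

lemma related_ext:
  assumes "full S H" "full S B" "component_closed S" "\<sigma> \<in> S"
    and "\<And>n. related \<alpha> H B \<sigma> (f n) (g n)"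
  shows "related \<alpha> H B \<sigma> (f (dialogue d \<alpha>)) (ext B \<sigma> g d)"
  using assms(4,5)
proof (induction \<sigma> arbitrary: f g)
  case Iota
  then show ?case
    using assms(2) by (simp add: incl_in_El val_incl dialogue_kleisli)
next
  case (Fn \<sigma> \<tau>)
  note S = component_closedD(2)[OF assms(3) Fn.prems(1)]
  have gn: "g n \<in> El B (\<sigma> \<Rrightarrow> \<tau>)" for n
    using Fn.prems(2) by (rule related_in_El)
  have body: "ext B \<tau> (\<lambda>n. app B (g n) s) d \<in> El B \<tau>" if "s \<in> El B \<sigma>" for s
    using app_in_El[OF assms(2) Fn.prems(1) gn that] by (intro ext_in_El[OF assms(2,3) S])
  have "related \<alpha> H B \<tau> (app H (f (dialogue d \<alpha>)) x) (app B (ext B (\<sigma> \<Rrightarrow> \<tau>) g d) s)"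
    if r: "related \<alpha> H B \<sigma> x s" for x s
  proof -
    \<comment> \<open>The induction hypothesis is applied to the families
      \<open>\<lambda>n. app H (f n) x\<close> and \<open>\<lambda>n. app B (g n) s\<close>.\<close>
    have "related \<alpha> H B \<tau> (app H (f (dialogue d \<alpha>)) x) (ext B \<tau> (\<lambda>n. app B (g n) s) d)"
      using Fn.prems(2) r by (intro Fn.IH(2)[OF S]) auto
    then show ?thesis
      using app_lam[OF assms(2) Fn.prems(1) body] related_in_El(2)[OF r] by simp
  qed
  then show ?case
    using Fn.prems(2) ext_in_El[OF assms(2,3) Fn.prems(1) gn]
    by (simp del: ext.simps)
qed

section \<open>The fundamental lemma\<close>

text \<open>The induction keeps \<open>S\<close> fixed, since subterms contribute fewer types, and
  generalises the environments, which \<open>Lam\<close> extends.\<close>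

lemma related_sem_bsem:
  fixes H :: "(nat, 'u) hierarchy" and B :: "(nat DN, 'v) hierarchy"
  assumes "\<Gamma> \<turnstile> t : \<sigma>" "distinct (map fst \<Gamma>)" "subterm_types \<Gamma> t \<subseteq> S"
    and "full S H" "full S B" "component_closed S"
    and "\<And>x \<tau>. (x, \<tau>) \<in> set \<Gamma> \<Longrightarrow> related \<alpha> H B \<tau> (\<gamma> x) (\<delta> x)"
  shows "related \<alpha> H B \<sigma> (sem H \<Gamma> t \<gamma>) (bsem B \<Gamma> t \<delta>)"
  using assms(1-3,7)
proof (induction arbitrary: \<gamma> \<delta> rule: typing.induct)
  case (t_var x \<sigma> \<Gamma>)
  then show ?case by simp
next
  case (t_zero \<Gamma>)
  then show ?case
    unfolding sem.simps bsem.simps by (intro related_incl[OF assms(4,5)]) auto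
next
  case (t_succ \<Gamma> t)
  then have "related \<alpha> H B \<iota> (sem H \<Gamma> t \<gamma>) (bsem B \<Gamma> t \<delta>)"
    by (intro t_succ.IH) auto
  then show ?case
    unfolding sem.simps bsem.simps
    using t_succ.prems(2)
    by (intro related_incl[OF assms(4,5)]) (auto simp: dialogue_mapD)
next
  case (t_rec \<Gamma> t \<sigma> p q)
  have S: "\<iota> \<Rrightarrow> \<sigma> \<Rrightarrow> \<sigma> \<in> S"
    using type_in_subterm_types[OF t_rec.hyps(1)] t_rec.prems by auto
  have t: "related \<alpha> H B (\<iota> \<Rrightarrow> \<sigma> \<Rrightarrow> \<sigma>) (sem H \<Gamma> t \<gamma>) (bsem B \<Gamma> t \<delta>)"
    and p: "related \<alpha> H B \<sigma> (sem H \<Gamma> p \<gamma>) (bsem B \<Gamma> p \<delta>)"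
    and q: "related \<alpha> H B \<iota> (sem H \<Gamma> q \<gamma>) (bsem B \<Gamma> q \<delta>)"
    using t_rec.prems by (auto intro!: t_rec.IH simp del: related.simps)
  have n: "related \<alpha> H B \<iota> (incl H n) (incl B (Eta n))" for n
    using component_closedD(1)[OF assms(6) S] by (intro related_incl[OF assms(4,5)]) auto
  have "related \<alpha> H B \<sigma>
     (natrec (\<lambda>n. app H (app H (sem H \<Gamma> t \<gamma>) (incl H n))) (sem H \<Gamma> p \<gamma>) n)
     (natrec (\<lambda>n. app B (app B (bsem B \<Gamma> t \<delta>) (incl B (Eta n)))) (bsem B \<Gamma> p \<delta>) n)" for n
  proof (rule related_natrec[OF p])
    fix n x d
    assume "related \<alpha> H B \<sigma> x d"
    then show "related \<alpha> H B \<sigma> (app H (app H (sem H \<Gamma> t \<gamma>) (incl H n)) x)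
        (app B (app B (bsem B \<Gamma> t \<delta>) (incl B (Eta n))) d)"
      by (rule related_app[OF related_app[OF t n]])
  qed
  \<comment> \<open>The number of iterations in \<open>sem\<close> is the value along
    \<open>\<alpha>\<close> of the tree for \<open>q\<close>, which is the index that
    \<open>related_ext\<close> selects.\<close>
  moreover have "\<sigma> \<in> S" "val H (sem H \<Gamma> q \<gamma>) = dialogue (val B (bsem B \<Gamma> q \<delta>)) \<alpha>"
    using t_rec.prems(2) q by simp_all
  ultimately show ?case
    unfolding sem.simps bsem.simps by (simp only: related_ext[OF assms(4-6)])
next
  case (t_lam x \<Gamma> \<sigma> t \<tau>)
  have S: "\<sigma> \<Rrightarrow> \<tau> \<in> S"
    using type_in_subterm_types[OF typing.t_lam[OF t_lam.hyps(1,2)]] t_lam.prems by auto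
  have d: "distinct (map fst ((x, \<sigma>) # \<Gamma>))"
    using t_lam by simp
  have st: "subterm_types ((x, \<sigma>) # \<Gamma>) t \<subseteq> S"
    using t_lam.prems by simp
  have fresh: "y \<noteq> x" if "(y, \<rho>) \<in> set \<Gamma>" for y \<rho>
    using that t_lam.hyps(1) by force
  have "related \<alpha> H B (\<sigma> \<Rrightarrow> \<tau>)
     (lam H \<sigma> \<tau> (\<lambda>a. sem H ((x, \<sigma>) # \<Gamma>) t (\<gamma>(x := a))))
     (lam B \<sigma> \<tau> (\<lambda>a. bsem B ((x, \<sigma>) # \<Gamma>) t (\<delta>(x := a))))"
  proof (rule related_lam[OF assms(4,5) S])
    \<comment> \<open>Related environments take values in the carriers, so each interpretation can
      be treated on its own here.\<close>
    show "sem H ((x, \<sigma>) # \<Gamma>) t (\<gamma>(x := a)) \<in> El H \<tau>" if "a \<in> El H \<sigma>" for a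
      using that fresh related_in_El(1)[OF t_lam.prems(3)]
      by (intro sem_in_El[OF t_lam.hyps(2) d st assms(4,6)]) auto
    show "bsem B ((x, \<sigma>) # \<Gamma>) t (\<delta>(x := a)) \<in> El B \<tau>" if "a \<in> El B \<sigma>" for a
      using that fresh related_in_El(2)[OF t_lam.prems(3)]
      by (intro bsem_in_El[OF t_lam.hyps(2) d st assms(5,6)]) auto
    show "related \<alpha> H B \<tau> (sem H ((x, \<sigma>) # \<Gamma>) t (\<gamma>(x := a))) (bsem B ((x, \<sigma>) # \<Gamma>) t (\<delta>(x := b)))"
      if "related \<alpha> H B \<sigma> a b" for a b
      using that fresh t_lam.prems(3) by (intro t_lam.IH d st) auto
  qed
  \<comment> \<open>The codomain computed by \<open>type_of\<close> in both interpretations is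
    \<tau>.\<close>
  then show ?case
    by (simp only: sem.simps bsem.simps type_of_eq[OF t_lam.hyps(2) d])
next
  case (t_app \<Gamma> t \<sigma> \<tau> p)
  have "related \<alpha> H B (\<sigma> \<Rrightarrow> \<tau>) (sem H \<Gamma> t \<gamma>) (bsem B \<Gamma> t \<delta>)"
    and "related \<alpha> H B \<sigma> (sem H \<Gamma> p \<gamma>) (bsem B \<Gamma> p \<delta>)"
    using t_app.prems by (auto intro!: t_app.IH simp del: related.simps)
  then show ?case
    unfolding sem.simps bsem.simps by (rule related_app)
qed

text \<open>Both lifts are \<open>lam\<close>s, so the claim reduces to \<iota>, where it is
  \<open>dialogue_generic\<close>.\<close>

lemma related_lift_generic:
  fixes H :: "(nat, 'u) hierarchy" and B :: "(nat DN, 'v) hierarchy"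
  assumes "full S H" "full S B" "component_closed S" "\<iota> \<Rrightarrow> \<iota> \<in> S"
  shows "related \<alpha> H B (\<iota> \<Rrightarrow> \<iota>) (lift H \<alpha>) (lift B generic)"
proof -
  have "\<iota> \<in> S"
    using component_closedD(1)[OF assms(3,4)] .
  then show ?thesis
    unfolding lift_def
    by (intro related_lam[OF assms(1,2,4)] related_incl[OF assms(1,2)]
        incl_in_El[OF assms(1)] incl_in_El[OF assms(2)])
      (auto simp: dialogue_generic)
qed

theorem theorem16:
  fixes \<alpha> :: "nat \<Rightarrow> nat"
    and t :: tm
    and H :: "(nat, 'u) hierarchy"
    and B :: "(nat DN, 'v) hierarchy"
  assumes "[] \<turnstile> t : (\<iota> \<Rrightarrow> \<iota>) \<Rrightarrow> \<iota>"
    and "full (types_in t) H"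
    and "full (types_in t) B"
  shows "val H (app H (sem_closed H t) (lift H \<alpha>)) = dialogue (dialogue_tree B t) \<alpha>"
proof -
  note closed = component_closed_types_in[of t]
  have "(\<iota> \<Rrightarrow> \<iota>) \<Rrightarrow> \<iota> \<in> types_in t"
    using type_in_subterm_types[OF assms(1)] subterm_types_subset_types_in by auto
  then have "\<iota> \<Rrightarrow> \<iota> \<in> types_in t"
    by (rule component_closedD[OF closed])
  then have \<alpha>: "related \<alpha> H B (\<iota> \<Rrightarrow> \<iota>) (lift H \<alpha>) (lift B generic)"
    by (rule related_lift_generic[OF assms(2,3) closed])
  \<comment> \<open>In the empty context the condition on environments is vacuous, so
    \<open>undefined\<close> is harmless.\<close>
  have t: "related \<alpha> H B ((\<iota> \<Rrightarrow> \<iota>) \<Rrightarrow> \<iota>) (sem_closed H t) (bsem_closed B t)"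
    unfolding sem_closed_def bsem_closed_def
    by (rule related_sem_bsem[OF assms(1) _ subterm_types_subset_types_in assms(2,3) closed])
      simp_all
  show ?thesis
    \<comment> \<open>At \<iota> the relation contains the claimed equation.\<close>
    using related_app[OF t \<alpha>] unfolding dialogue_tree_def by simp
qed

end
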